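(* Let $G$ be a finite simple graph with vertices $v_1,\ldots,v_n$, let $w_0$ be a weight of $G$, let $a_0=\chi(G,w_0)$, let $C_0$ be an $(\mathcal L_{a_0},w_0)$-coloring of $G$, and let $w$ be a weight of $G$ with $\vec w\ge\vec w_0$. Then $$\chi(G,w,C_0)\le a_0+\min_{\vec w'\in\vec\delta(G,\mathcal L_{a_0},C_0,w)}\chi(G,w').$$
   Context: For an integer $a\ge1$, $\mathcal L_a$ is the list assigning $\{1,\ldots,a\}$ to every vertex. A weight is a map $w:V(G)\to\mathbb N$ with weight-vector $\vec w=\sum_i w(v_i)\vec e_i\in\mathbb N^n$ (and conversely a vector $\vec w'\in\mathbb N^n$ determines a weight $w'$). For a list $L$ (finite sets $L(v)\subset\mathbb N$), an $(L,w)$-coloring is a map $C$ with $C(v)\subset L(v)$, $|C(v)|=w(v)$ and $C(v)\cap C(v')=\emptyset$ for every edge $vv'$; $\vec w(C)=\sum_i|C(v_i)|\vec e_i$. The weighted chromatic number $\chi(G,w)$ is the smallest integer $a\ge1$ such that $G$ is $(\mathcal L_a,w)$-colorable. $\vec y\le\vec x$ means coordinatewise inequality; $\min(\vec x,\vec y)$ is the coordinatewise minimum. For a coloring $C$ and $\vec d\in\mathbb N^n$, $\mathcal C^-(C,\vec d)$ is the set of maps $C'$ with $C'(v)\subset C(v)$ for all $v$ and $\vec w(C')=\vec w(C)-\vec d$. $\chi(G,w,C_0)$ is the smallest $a$ such that there exists an $(\mathcal L_a,w)$-coloring $C$ of $G$ with $C_0\in\mathcal C^-(C,\vec w-\vec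 w_0)$. For $N\subset V(G)$, $\vec N=\sum_i\lambda_i\vec e_i$ ($\lambda_i=1$ iff $v_i\in N$). For a list $L$ with $\overline L=\bigcup_vL(v)$ and a color $x$, $G^x$ is the subgraph induced by the vertices $v$ with $x\in L(v)$; $\overrightarrow{MIS}(H)=\{\vec N: N$ a maximal (w.r.t. inclusion) independent set of $H\}$; $\overrightarrow{W}_{max}(G,L)=\sum_{x\in\overline L}\overrightarrow{MIS}(G^x)$ (vectorial sum of sets). $\overrightarrow{W}_{max}(G,\mathcal L_{a_0},C_0)$ is the set of $\vec w_1\in\overrightarrow{W}_{max}(G,\mathcal L_{a_0})$ such that there is an $(\mathcal L_{a_0},w_1)$-coloring $C_1$ with $C_0\in\mathcal C^-(C_1,\vec w_1-\vec w_0)$. Finally $\vec\delta(G,\mathcal L_{a_0},C_0,w)=\{\vec w-\min(\vec w,\vec w_1):\vec w_1\in\overrightarrow{W}_{max}(G,\mathcal L_{a_0},C_0)\}$. *)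

theory Defs
  imports
    "Graph_Theory.Digraph_Component"
    "HOL-Library.Indicator_Function"
    "HOL-Library.Function_Algebras"
    "HOL-Library.Set_Algebras"
begin

text \<open>
  A finite simple graph is a \<open>graph\<close> in the sense of the library: a finite, loop-free,
  symmetric digraph without parallel arcs, where an undirected edge is a pair of opposite arcs.
  Weights and vectors indexed by the vertices are functions \<open>'a \<Rightarrow> nat\<close>, of which only the values
  on \<open>verts G\<close> matter; the same holds for lists and colorings \<open>'a \<Rightarrow> nat set\<close>.
\<close>

definition const_list :: "nat \<Rightarrow> 'a \<Rightarrow> nat set" where
  "const_list a = (\<lambda>v. {1..a})"

text \<open>Lists \<open>L\<close> are meant to be finite, so that \<open>card\<close> is the true cardinality.\<close>

definition is_coloring ::
  "('a,'b) pre_digraph \<Rightarrow> ('a \<Rightarrow> nat set) \<Rightarrow> ('a \<Rightarrow> nat) \<Rightarrow> ('a \<Rightarrow> nat set) \<Rightarrow> bool" where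
  "is_coloring G L w C \<longleftrightarrow>
     (\<forall>v \<in> verts G. C v \<subseteq> L v \<and> card (C v) = w v) \<and>
     (\<forall>u v. u \<rightarrow>\<^bsub>G\<^esub> v \<longrightarrow> C u \<inter> C v = {})"

definition chromatic_number :: "('a,'b) pre_digraph \<Rightarrow> ('a \<Rightarrow> nat) \<Rightarrow> nat" where
  "chromatic_number G w = (LEAST a. 1 \<le> a \<and> (\<exists>C. is_coloring G (const_list a) w C))"

text \<open>The equation between weight vectors is stated in the integers, so that the subtraction is
  not truncated.\<close>

definition sub_colorings ::
  "('a,'b) pre_digraph \<Rightarrow> ('a \<Rightarrow> nat set) \<Rightarrow> ('a \<Rightarrow> nat) \<Rightarrow> ('a \<Rightarrow> nat set) set" where
  "sub_colorings G C d =
     {C'. \<forall>v \<in> verts G. C' v \<subseteq> C v \<and> int (card (C' v)) = int (card (C v)) - int (d v)}"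

text \<open>In the notions relative to a coloring \<open>C0\<close>, the weight \<open>w0\<close> of \<open>C0\<close> is an explicit
  argument. The differences \<open>w v - w0 v\<close> and \<open>w1 v - w0 v\<close> below are never really truncated: if
  \<open>C0\<close> has weight \<open>w0\<close>, membership in \<open>sub_colorings\<close> forces \<open>w0 v \<le> w v\<close>, resp.
  \<open>w0 v \<le> w1 v\<close>.\<close>

definition chromatic_number_ext ::
  "('a,'b) pre_digraph \<Rightarrow> ('a \<Rightarrow> nat) \<Rightarrow> ('a \<Rightarrow> nat) \<Rightarrow> ('a \<Rightarrow> nat set) \<Rightarrow> nat" where
  "chromatic_number_ext G w w0 C0 =
     (LEAST a. 1 \<le> a \<and>
        (\<exists>C. is_coloring G (const_list a) w C \<and> C0 \<in> sub_colorings G C (\<lambda>v. w v - w0 v)))"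

definition independent_set :: "('a,'b) pre_digraph \<Rightarrow> 'a set \<Rightarrow> bool" where
  "independent_set H N \<longleftrightarrow> N \<subseteq> verts H \<and> (\<forall>u \<in> N. \<forall>v \<in> N. \<not> u \<rightarrow>\<^bsub>H\<^esub> v)"

definition maximal_independent_set :: "('a,'b) pre_digraph \<Rightarrow> 'a set \<Rightarrow> bool" where
  "maximal_independent_set H N \<longleftrightarrow>
     independent_set H N \<and> (\<forall>M. independent_set H M \<and> N \<subseteq> M \<longrightarrow> M = N)"

definition MIS_vec :: "('a,'b) pre_digraph \<Rightarrow> ('a \<Rightarrow> nat) set" where
  "MIS_vec H = {indicator N | N. maximal_independent_set H N}"

definition color_subgraph ::
  "('a,'b) pre_digraph \<Rightarrow> ('a \<Rightarrow> nat set) \<Rightarrow> nat \<Rightarrow> ('a,'b) pre_digraph" where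
  "color_subgraph G L x = G \<restriction> {v \<in> verts G. x \<in> L v}"

text \<open>The sum is the elementwise (Minkowski) sum of sets of vectors.\<close>

definition W_max :: "('a,'b) pre_digraph \<Rightarrow> ('a \<Rightarrow> nat set) \<Rightarrow> ('a \<Rightarrow> nat) set" where
  "W_max G L = (\<Sum>x \<in> (\<Union>v \<in> verts G. L v). MIS_vec (color_subgraph G L x))"

definition W_max_ext ::
  "('a,'b) pre_digraph \<Rightarrow> ('a \<Rightarrow> nat set) \<Rightarrow> ('a \<Rightarrow> nat) \<Rightarrow> ('a \<Rightarrow> nat set) \<Rightarrow> ('a \<Rightarrow> nat) set" where
  "W_max_ext G L w0 C0 =
     {w1 \<in> W_max G L.
        \<exists>C1. is_coloring G L w1 C1 \<and> C0 \<in> sub_colorings G C1 (\<lambda>v. w1 v - w0 v)}"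

definition delta_vec ::
  "('a,'b) pre_digraph \<Rightarrow> ('a \<Rightarrow> nat set) \<Rightarrow> ('a \<Rightarrow> nat) \<Rightarrow> ('a \<Rightarrow> nat set) \<Rightarrow> ('a \<Rightarrow> nat)
     \<Rightarrow> ('a \<Rightarrow> nat) set" where
  "delta_vec G L w0 C0 w = {(\<lambda>v. w v - min (w v) (w1 v)) | w1. w1 \<in> W_max_ext G L w0 C0}"

end

theory Submission
  imports Defs
begin

text \<open>
  Given \<open>w1\<close> in \<open>W_max_ext\<close> with its coloring \<open>C1\<close>, cut \<open>C1\<close> down to weight \<open>min w w1\<close> while
  keeping \<open>C0\<close> inside, and color the missing weight \<open>w - min w w1\<close> optimally with fresh colors,
  all larger than \<open>a0\<close>. The minimum is attained, because \<open>W_max_ext\<close> is finite and it is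
  nonempty: extending each color class of \<open>C0\<close> to a maximal independent set gives an element.
\<close>

lemma sum_apply: "(\<Sum>x\<in>A. f x) v = (\<Sum>x\<in>A. f x v)"
  for f :: "'b \<Rightarrow> 'a \<Rightarrow> 'c::comm_monoid_add"
  by (induction A rule: infinite_finite_induct) simp_all

lemma (in wf_digraph) dominates_induce_subgraph_iff:
  "u \<rightarrow>\<^bsub>G \<restriction> S\<^esub> v \<longleftrightarrow> u \<in> S \<and> v \<in> S \<and> u \<rightarrow>\<^bsub>G\<^esub> v"
  by (auto simp: arcs_ends_def arc_to_ends_def image_def)

text \<open>A constant list offers every color of \<open>{1..a}\<close> at every vertex, so
  restricting to the vertices that may use \<open>x\<close> loses nothing.\<close>

lemma color_subgraph_const_list:
  assumes "wf_digraph G" "x \<in> {1..a}"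
  shows "verts (color_subgraph G (const_list a) x) = verts G"
    and "u \<rightarrow>\<^bsub>color_subgraph G (const_list a) x\<^esub> v \<longleftrightarrow> u \<rightarrow>\<^bsub>G\<^esub> v"
proof -
  interpret wf_digraph G by fact
  show "verts (color_subgraph G (const_list a) x) = verts G"
    using assms(2) by (auto simp: color_subgraph_def const_list_def)
  show "u \<rightarrow>\<^bsub>color_subgraph G (const_list a) x\<^esub> v \<longleftrightarrow> u \<rightarrow>\<^bsub>G\<^esub> v"
    using assms(2) adj_in_verts
    by (auto simp: color_subgraph_def const_list_def dominates_induce_subgraph_iff)
qed

lemma independent_set_extend_maximal:
  assumes "finite (verts H)" "independent_set H N"
  obtains M where "N \<subseteq> M" "maximal_independent_set H M"
proof -
  have "finite {M. independent_set H M}"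
    by (rule finite_subset[of _ "Pow (verts H)"]) (use assms(1) in \<open>auto simp: independent_set_def\<close>)
  from finite_has_maximal2[OF this, of N] assms(2) obtain M
    where "independent_set H M" "N \<subseteq> M" "\<forall>K. independent_set H K \<longrightarrow> M \<subseteq> K \<longrightarrow> M = K"
    by auto
  then show thesis
    by (intro that[of M]) (auto simp: maximal_independent_set_def)
qed

text \<open>The vectors are functions on a possibly infinite type, but each is determined by a
  subset of the finite vertex set.\<close>

lemma finite_MIS_vec:
  assumes "finite (verts H)"
  shows "finite (MIS_vec H)"
proof (rule finite_subset)
  show "MIS_vec H \<subseteq> indicator ` Pow (verts H)"
    by (auto simp: MIS_vec_def maximal_independent_set_def independent_set_def)
qed (use assms in simp)

text \<open>Over an infinite index set the sum defaults to the zero of sets, the singleton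
  \<open>{0}\<close>, so \<open>finite_W_max\<close> can cover arbitrary lists.\<close>

lemma finite_sum_sets:
  fixes S :: "'b \<Rightarrow> 'c::comm_monoid_add set"
  assumes "\<And>x. x \<in> A \<Longrightarrow> finite (S x)"
  shows "finite (\<Sum>x\<in>A. S x)"
  using assms by (induction A rule: infinite_finite_induct) (auto simp: finite_set_plus)

lemma finite_W_max:
  assumes "finite (verts G)"
  shows "finite (W_max G L)"
  unfolding W_max_def
  using assms by (intro finite_sum_sets finite_MIS_vec) (simp add: color_subgraph_def)

text \<open>A crude coloring by pairwise disjoint blocks of colors, one block per vertex. It
  guarantees that the \<open>LEAST\<close> in \<open>chromatic_number\<close> is attained.\<close>

lemma coloring_exists:
  assumes "graph G"
  shows "\<exists>a\<ge>1. \<exists>C. is_coloring G (const_list a) w C"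
proof -
  interpret graph G by fact
  obtain f :: "'a \<Rightarrow> nat" and n where f: "f ` verts G = {i. i < n}" "inj_on f (verts G)"
    using finite_imp_inj_to_nat_seg[OF finite_verts] by blast
  \<comment> \<open>The common block length: any upper bound of all weights would do.\<close>
  define K where "K = (\<Sum>v\<in>verts G. w v)"
  have K: "w v \<le> K" if "v \<in> verts G" for v
    unfolding K_def using that by (intro member_le_sum) auto
  \<comment> \<open>The first \<open>w v\<close> colors of block number \<open>f v\<close>; the
    offset 1 is there because colors start at 1.\<close>
  define C where "C v = {f v * K + 1..f v * K + w v}" for v
  have block: "f v * K + w v \<le> m * K" if "v \<in> verts G" "f v < m" for v m
  proof -
    have "f v * K + w v \<le> Suc (f v) * K" using K[OF that(1)] by simp
    also have "\<dots> \<le> m * K" using that(2) by (intro mult_le_mono1) simp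
    finally show ?thesis .
  qed
  \<comment> \<open>\<open>Suc\<close> keeps the number of colors positive when \<open>n * K\<close>
    is 0.\<close>
  have "C v \<subseteq> {1..Suc (n * K)}" if "v \<in> verts G" for v
  proof -
    have "f v < n" using f(1) that by blast
    then show ?thesis using block[OF that, of n] by (auto simp: C_def)
  qed
  moreover have "C u \<inter> C v = {}" if "u \<rightarrow>\<^bsub>G\<^esub> v" for u v
  proof -
    have uv: "u \<in> verts G" "v \<in> verts G" "u \<noteq> v"
      using that adj_in_verts adj_not_same by blast+
    then have "f u \<noteq> f v" using f(2) by (auto dest: inj_onD)
    then have "f u * K + w u \<le> f v * K \<or> f v * K + w v \<le> f u * K"
      using block uv by (meson nat_neq_iff)
    then show ?thesis
      by (auto simp: C_def)
  qed
  ultimately have "is_coloring G (const_list (Suc (n * K))) w C"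
    by (auto simp: is_coloring_def const_list_def C_def)
  then show ?thesis by (intro exI[of _ "Suc (n * K)"]) auto
qed

lemma chromatic_number_coloring:
  assumes "graph G"
  obtains C where "is_coloring G (const_list (chromatic_number G w)) w C"
    and "1 \<le> chromatic_number G w"
  using LeastI_ex[OF coloring_exists[OF assms, of w]] that
  unfolding chromatic_number_def by blast

lemma W_max_ext_nonempty:
  assumes "graph G" and C0: "is_coloring G (const_list a) w0 C0"
  shows "W_max_ext G (const_list a) w0 C0 \<noteq> {}"
proof -
  interpret graph G by fact
  note H = color_subgraph_const_list[OF wf_digraph_axioms]
  have "\<exists>M. {v \<in> verts G. x \<in> C0 v} \<subseteq> M \<and>
      maximal_independent_set (color_subgraph G (const_list a) x) M"
    if "x \<in> {1..a}" for x
  proof -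
    have "finite (verts (color_subgraph G (const_list a) x))"
      using that by (simp add: H)
    moreover have "independent_set (color_subgraph G (const_list a) x) {v \<in> verts G. x \<in> C0 v}"
      using that C0 unfolding independent_set_def is_coloring_def by (simp add: H) blast
    ultimately show ?thesis
      by (rule independent_set_extend_maximal) blast
  qed
  then obtain M where M: "\<And>x. x \<in> {1..a} \<Longrightarrow> {v \<in> verts G. x \<in> C0 v} \<subseteq> M x"
      "\<And>x. x \<in> {1..a} \<Longrightarrow> maximal_independent_set (color_subgraph G (const_list a) x) (M x)"
    by metis
  \<comment> \<open>The index set of the sum in \<open>W_max\<close>. It is \<open>{1..a}\<close> if
    there is a vertex and empty otherwise.\<close>
  define X where "X = (\<Union>v\<in>verts G. const_list a v)"
  have X: "X \<subseteq> {1..a}" "v \<in> verts G \<Longrightarrow> X = {1..a}" for v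
    by (auto simp: X_def const_list_def)
  then have "finite X" using finite_subset by blast
  \<comment> \<open>At \<open>v\<close> this sum counts the colors \<open>x\<close> with
    \<open>v\<close> in \<open>M x\<close>, which are exactly the colors in
    \<open>C1 v\<close>.\<close>
  define w1 :: "'a \<Rightarrow> nat" where "w1 = (\<Sum>x\<in>X. indicator (M x))"
  define C1 where "C1 v = {x \<in> X. v \<in> M x}" for v
  have "indicator (M x) \<in> MIS_vec (color_subgraph G (const_list a) x)" if "x \<in> X" for x
    unfolding MIS_vec_def using M(2) X(1) that by blast
  then have w1: "w1 \<in> W_max G (const_list a)"
    unfolding W_max_def X_def[symmetric] set_sum_alt[OF \<open>finite X\<close>] w1_def
    by blast
  have card_C1: "card (C1 v) = w1 v" for v
    using \<open>finite X\<close>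
    by (simp add: w1_def C1_def sum_apply indicator_def Int_def flip: sum.inter_filter)
  have "is_coloring G (const_list a) w1 C1"
    unfolding is_coloring_def
  proof (intro conjI ballI allI impI card_C1)
    show "C1 v \<subseteq> const_list a v" for v
      using X(1) by (auto simp: C1_def const_list_def)
    show "C1 u \<inter> C1 v = {}" if "u \<rightarrow>\<^bsub>G\<^esub> v" for u v
    proof -
      \<comment> \<open>Each \<open>M x\<close> is independent in the color subgraph, which has the
        arcs of \<open>G\<close>.\<close>
      have "\<not> (u \<in> M x \<and> v \<in> M x)" if "x \<in> X" for x
      proof -
        have x: "x \<in> {1..a}" using that X(1) by blast
        show ?thesis
          using M(2)[OF x] \<open>u \<rightarrow>\<^bsub>G\<^esub> v\<close> H(2)[OF x]
          unfolding maximal_independent_set_def independent_set_def by blast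
      qed
      then show ?thesis by (auto simp: C1_def)
    qed
  qed
  moreover have "C0 \<in> sub_colorings G C1 (\<lambda>v. w1 v - w0 v)"
  proof -
    have "C0 v \<subseteq> {1..a}" "card (C0 v) = w0 v" if "v \<in> verts G" for v
      using C0 that by (simp_all add: is_coloring_def const_list_def)
    moreover from this have "C0 v \<subseteq> C1 v" if "v \<in> verts G" for v
      using M(1) that unfolding C1_def X(2)[OF that] by blast
    \<comment> \<open>This makes the natural subtraction \<open>w1 v - w0 v\<close> exact, as the
      integer equation in \<open>sub_colorings\<close> requires.\<close>
    moreover from this have "w0 v \<le> w1 v" if "v \<in> verts G" for v
      using card_mono[of "C1 v" "C0 v"] that \<open>finite X\<close> card_C1[of v] calculation
      by (simp add: C1_def)
    ultimately show ?thesis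
      by (auto simp: sub_colorings_def card_C1)
  qed
  ultimately show ?thesis using w1 by (auto simp: W_max_ext_def)
qed

text \<open>The bound for one fixed \<open>w1\<close>; the theorem applies it to a \<open>w1\<close>
  attaining the minimum.\<close>

lemma chromatic_number_ext_le:
  assumes "graph G" and C0: "is_coloring G (const_list a) w0 C0"
    and w: "\<forall>v \<in> verts G. w0 v \<le> w v"
    and w1: "w1 \<in> W_max_ext G (const_list a) w0 C0"
  shows "chromatic_number_ext G w w0 C0
    \<le> a + chromatic_number G (\<lambda>v. w v - min (w v) (w1 v))"
proof -
  interpret graph G by fact
  define b where "b = chromatic_number G (\<lambda>v. w v - min (w v) (w1 v))"
  obtain C2 where C2: "is_coloring G (const_list b) (\<lambda>v. w v - min (w v) (w1 v)) C2" and "1 \<le> b"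
    unfolding b_def by (rule chromatic_number_coloring[OF \<open>graph G\<close>])
  obtain C1 where C1: "is_coloring G (const_list a) w1 C1"
    and "C0 \<in> sub_colorings G C1 (\<lambda>v. w1 v - w0 v)"
    using w1 by (auto simp: W_max_ext_def)
  then have sub: "C0 v \<subseteq> C1 v" if "v \<in> verts G" for v
    using that by (auto simp: sub_colorings_def)
  have C1_le: "C1 v \<subseteq> {1..a}" and C2_le: "C2 v \<subseteq> {1..b}"
    and card_C0: "card (C0 v) = w0 v" and card_C1: "card (C1 v) = w1 v"
    and card_C2: "card (C2 v) = w v - min (w v) (w1 v)"
    if "v \<in> verts G" for v
    using C1 C2 C0 that by (simp_all add: is_coloring_def const_list_def)
  have fin: "finite (C1 v)" "finite (C2 v)" if "v \<in> verts G" for v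
    using C1_le[OF that] C2_le[OF that] by (simp_all add: finite_subset)
  \<comment> \<open>There is room for \<open>B\<close>: \<open>w0 v\<close> is at most
    \<open>w v\<close> by assumption and at most \<open>w1 v\<close> because \<open>C0 v\<close>
    lies inside \<open>C1 v\<close>.\<close>
  have "\<exists>B. C0 v \<subseteq> B \<and> B \<subseteq> C1 v \<and> card B = min (w v) (w1 v)" if "v \<in> verts G" for v
  proof (rule exists_subset_between)
    show "card (C0 v) \<le> min (w v) (w1 v)"
      using card_mono[OF fin(1) sub] w that by (simp add: card_C0 card_C1)
  qed (use that fin sub card_C1 in simp_all)
  then obtain B where B: "C0 v \<subseteq> B v" "B v \<subseteq> C1 v" "card (B v) = min (w v) (w1 v)"
    if "v \<in> verts G" for v
    by metis
  \<comment> \<open>Old colors are at most \<open>a\<close>, shifted ones exceed \<open>a\<close>.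
    Distinct \<open>u\<close> and \<open>v\<close> are allowed, to settle the mixed intersections
    along an arc.\<close>
  have fresh: "B u \<inter> (+) a ` C2 v = {}" if "u \<in> verts G" "v \<in> verts G" for u v
    using C1_le[OF that(1)] C2_le[OF that(2)] B(2)[OF that(1)] by fastforce
  define C where "C v = B v \<union> (+) a ` C2 v" for v
  have "is_coloring G (const_list (a + b)) w C"
    unfolding is_coloring_def
  proof (intro conjI ballI allI impI)
    fix v assume v: "v \<in> verts G"
    show "C v \<subseteq> const_list (a + b) v"
      using C1_le[OF v] C2_le[OF v] B(2)[OF v] by (fastforce simp: C_def const_list_def)
    show "card (C v) = w v"
      using fresh[OF v v] fin[OF v] B(2,3)[OF v] card_C2[OF v] finite_subset[OF B(2)[OF v]]
      by (simp add: C_def card_Un_disjoint card_image)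
  next
    fix u v assume uv: "u \<rightarrow>\<^bsub>G\<^esub> v"
    then have vs: "u \<in> verts G" "v \<in> verts G" using adj_in_verts by blast+
    have "B u \<inter> B v = {}" "C2 u \<inter> C2 v = {}"
      using C1 C2 uv B(2)[OF vs(1)] B(2)[OF vs(2)] unfolding is_coloring_def by blast+
    then show "C u \<inter> C v = {}"
      using fresh[OF vs] fresh[OF vs(2,1)] by (auto simp: C_def)
  qed
  moreover from this have "C0 \<in> sub_colorings G C (\<lambda>v. w v - w0 v)"
    using B(1) w card_C0 by (auto simp: sub_colorings_def is_coloring_def C_def)
  \<comment> \<open>So \<open>a + b\<close> is a candidate for the \<open>LEAST\<close>, and it is
    positive because \<open>b\<close> is.\<close>
  ultimately show ?thesis
    unfolding chromatic_number_ext_def b_def[symmetric]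
    using \<open>1 \<le> b\<close> by (intro Least_le) auto
qed

theorem theorem7p1:
  fixes G :: "('a,'b) pre_digraph"
    and w0 w :: "'a \<Rightarrow> nat"
    and C0 :: "'a \<Rightarrow> nat set"
    and a0 :: nat
  assumes "graph G"
    and "a0 = chromatic_number G w0"
    and "is_coloring G (const_list a0) w0 C0"
    and "\<forall>v \<in> verts G. w0 v \<le> w v"
  shows "chromatic_number_ext G w w0 C0
           \<le> a0 + Min (chromatic_number G ` delta_vec G (const_list a0) w0 C0 w)"
proof -
  interpret graph G by fact
  let ?D = "delta_vec G (const_list a0) w0 C0 w"
  \<comment> \<open>Written as an image, \<open>?D\<close> inherits finiteness and nonemptiness from
    \<open>W_max_ext\<close>.\<close>
  have D: "?D = (\<lambda>w1 v. w v - min (w v) (w1 v)) ` W_max_ext G (const_list a0) w0 C0"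
    by (auto simp: delta_vec_def)
  have "finite (W_max_ext G (const_list a0) w0 C0)"
    using finite_W_max[OF finite_verts] by (simp add: W_max_ext_def)
  then have "Min (chromatic_number G ` ?D) \<in> chromatic_number G ` ?D"
    using W_max_ext_nonempty[OF assms(1,3)] by (intro Min_in) (auto simp: D)
  then obtain w1 where "w1 \<in> W_max_ext G (const_list a0) w0 C0"
    and "Min (chromatic_number G ` ?D) = chromatic_number G (\<lambda>v. w v - min (w v) (w1 v))"
    by (auto simp: D)
  then show ?thesis
    using chromatic_number_ext_le[OF assms(1,3,4)] by simp
qed

end
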